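(* Let $x_0\in\operatorname{int}(\operatorname{dom}\psi)$, $\delta\ge0$, and $L>0$ with $L\ge L_d(f)$. Let the sequence $\{x_k\}_{k\ge1}$ be generated from $x_0$ by the Inexact Gradient Method with Memory (defined in the context) with parameters $L$ and $\delta$, where for each $k \ge 0$ the finite set $\mathcal{Z}_k\subseteq\operatorname{dom}\psi$ is arbitrary subject to $x_k\in\mathcal{Z}_k$. Then, for any $T\ge1$ and any $y\in\operatorname{dom}\psi$, $$\frac{1}{T}\sum_{k=1}^T F(x_k)\le F(y)+\frac{L}{T}\,\beta_d(x_0,y)+\delta.$$
   Context: $\mathbb{E}$ is a finite-dimensional real vector space with dual $\mathbb{E}^*$; $\langle s,x\rangle$ is the value of $s\in\mathbb{E}^*$ at $x\in\mathbb{E}$ (the same notation is used for the standard inner product on $\mathbb{R}^m$). The prox-function $d$ is a closed convex function on $\mathbb{E}$, differentiable on $\operatorname{int}(\operatorname{dom} d)$, and strictly convex: $d(y) > d(x) + \langle \nabla d(x), y-x\rangle$ for all $x\in\operatorname{int}(\operatorname{dom} d)$, $y\in\operatorname{dom} d$, $x\ne y$. The Bregman distance is $\beta_d(x,y) = d(y)-d(x)-\langle\nabla d(x),y-x\rangle$ for $x\in\operatorname{int}(\operatorname{dom} d)$, $y \in \operatorname{dom} d$. $f$ is a differentiable closed convex function with open domain $\operatorname{dom} f\subseteq\operatorname{dom} d$, and $L_d(f)\ge\mu_d(f)\ge 0$ are constants such that for all $x,y\in\operatorname{dom} f$ $$\mu_d(f)\,\beta_d(x,y) \le f(y)-f(x)-\langle\nabla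 f(x),y-x\rangle \le L_d(f)\,\beta_d(x,y).$$ $\psi:\mathbb{E}\to\mathbb{R}\cup\{+\infty\}$ is a proper closed convex function with $\operatorname{dom}\psi\subseteq\operatorname{dom} f$ and $\operatorname{int}(\operatorname{dom}\psi)\neq\emptyset$. $F = f+\psi$, and the problem $\min_{x\in\operatorname{dom}\psi}F(x)$ is assumed to have a solution $x^*\in\operatorname{dom}\psi$, with $F^*=F(x^* )$. Standing assumption: for every $L>0$ and every $s\in\mathbb{E}^*$ the maximum $$\Phi_L(s)=\max_{y\in\operatorname{dom}\psi}\{\langle s,y\rangle - L d(y)-\psi(y)\}$$ is well defined (attained); its maximizer, unique by strict concavity, is denoted $y^*_L(s)$. The function $\Phi_L$ is differentiable with $\nabla\Phi_L(s)=y^*_L(s)$. One inexact iteration: given a point $\bar x\in \operatorname{dom}\psi$ (note that $\nabla d(\bar x)$ exists, since $\operatorname{dom}\psi\subseteq\operatorname{dom} f\subseteq\operatorname{int}(\operatorname{dom} d)$), a finite set $\mathcal{Z}=\{z_1,\dots,z_m\}\subseteq\operatorname{dom}\psi$ containing $\bar x$, $L>0$ and $\delta\ge0$, put $f_i=f(z_i)$, $g_i=\nabla f(z_i)$, $G\lambda=\sum_{i=1}^m\lambda^{(i)}g_i$ for $\lambda\in\mathbb{R}^m$, $f_*\in\mathbb{R}^m$ with $f_*^{(i)}=\langle g_i,z_i\rangle-f_i$, let $\Delta_m$ be the standard simplex in $\mathbb{R}^m$, and $$\xi_L(\lambda)=\Phi_L(L\nabla d(\bar x)-G\lambda)+\langle\lambda,f_*\rangle+\alpha,\qquad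 \alpha=L[d(\bar x)-\langle\nabla d(\bar x),\bar x\rangle].$$ Choose any $\bar\lambda\in\Delta_m$ with $\langle\bar\lambda-\lambda,\nabla\xi_L(\bar\lambda)\rangle\le\delta$ for all $\lambda\in\Delta_m$, and output $x_{\delta,L}(\bar x,\mathcal{Z}):=y^*_L(L\nabla d(\bar x)-G\bar\lambda)$. Inexact Gradient Method with Memory (IGMM): starting from $x_0$, for each $k\ge0$ choose a finite set $\mathcal{Z}_k\subseteq\operatorname{dom}\psi$ containing $x_k$, and set $x_{k+1}=x_{\delta,L}(x_k,\mathcal{Z}_k)$. *)

theory Defs
  imports "HOL-Analysis.Analysis"
begin

text \<open>
  The space is a Euclidean space \<open>'a\<close>, and its dual is the space \<open>'a \<Rightarrow>\<^sub>L real\<close> of (bounded) linear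
  functionals; the inner product of \<open>'a\<close> is never used.  Functions with values in the reals
  extended by plus infinity have type \<open>'a \<Rightarrow> ereal\<close>.  The operator \<open>real_of_ereal\<close> is
  applied to them only at points, or in neighbourhoods of points, where they are finite.
\<close>

definition edom :: "('a \<Rightarrow> ereal) \<Rightarrow> 'a set" where
  "edom h = {x. h x < \<infinity>}"

definition closed_convex :: "('a::euclidean_space \<Rightarrow> ereal) \<Rightarrow> bool" where
  "closed_convex h \<longleftrightarrow>
     (\<forall>x. h x \<noteq> -\<infinity>) \<and>
     convex {(x, t :: real). h x \<le> ereal t} \<and>
     closed {(x, t :: real). h x \<le> ereal t}"

definition differentiable_at :: "('a::euclidean_space \<Rightarrow> ereal) \<Rightarrow> 'a \<Rightarrow> bool" where
  "differentiable_at h x \<longleftrightarrow>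
     x \<in> interior (edom h) \<and> (\<lambda>y. real_of_ereal (h y)) differentiable (at x)"

definition grad :: "('a::euclidean_space \<Rightarrow> ereal) \<Rightarrow> 'a \<Rightarrow> ('a \<Rightarrow>\<^sub>L real)" where
  "grad h x = Blinfun (frechet_derivative (\<lambda>y. real_of_ereal (h y)) (at x))"

definition bregman :: "('a::euclidean_space \<Rightarrow> ereal) \<Rightarrow> 'a \<Rightarrow> 'a \<Rightarrow> real" where
  "bregman d x y =
     real_of_ereal (d y) - real_of_ereal (d x) - blinfun_apply (grad d x) (y - x)"

definition prox_function :: "('a::euclidean_space \<Rightarrow> ereal) \<Rightarrow> bool" where
  "prox_function d \<longleftrightarrow>
     closed_convex d \<and>
     (\<forall>x \<in> interior (edom d). differentiable_at d x) \<and>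
     (\<forall>x \<in> interior (edom d). \<forall>y \<in> edom d. x \<noteq> y \<longrightarrow>
        d y > d x + ereal (blinfun_apply (grad d x) (y - x)))"

definition dual_objective ::
    "('a::euclidean_space \<Rightarrow> ereal) \<Rightarrow> ('a \<Rightarrow> ereal) \<Rightarrow> real \<Rightarrow> ('a \<Rightarrow>\<^sub>L real) \<Rightarrow> 'a \<Rightarrow> real" where
  "dual_objective d \<psi> L s y =
     blinfun_apply s y - L * real_of_ereal (d y) - real_of_ereal (\<psi> y)"

definition Phi ::
    "('a::euclidean_space \<Rightarrow> ereal) \<Rightarrow> ('a \<Rightarrow> ereal) \<Rightarrow> real \<Rightarrow> ('a \<Rightarrow>\<^sub>L real) \<Rightarrow> real" where
  "Phi d \<psi> L s = (SUP y \<in> edom \<psi>. dual_objective d \<psi> L s y)"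

definition ystar ::
    "('a::euclidean_space \<Rightarrow> ereal) \<Rightarrow> ('a \<Rightarrow> ereal) \<Rightarrow> real \<Rightarrow> ('a \<Rightarrow>\<^sub>L real) \<Rightarrow> 'a" where
  "ystar d \<psi> L s = arg_max (dual_objective d \<psi> L s) (\<lambda>y. y \<in> edom \<psi>)"

text \<open>
  The number of points of the finite set \<open>Z\<close> changes from one iteration to the next.  Coordinates
  are therefore indexed by the points of \<open>Z\<close> themselves: a vector with one real component for
  each point of \<open>Z\<close> is a function \<open>'a \<Rightarrow> real\<close> of which only the values on \<open>Z\<close> matter.
\<close>

definition std_simplex :: "'a set \<Rightarrow> ('a \<Rightarrow> real) set" where
  "std_simplex Z =
     {l. (\<forall>z \<in> Z. 0 \<le> l z) \<and> (\<forall>z. z \<notin> Z \<longrightarrow> l z = 0) \<and> (\<Sum>z\<in>Z. l z) = 1}"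

text \<open>The component at \<open>z\<close> of the gradient, i.e. the partial derivative in the coordinate \<open>z\<close>.\<close>

definition grad_coord :: "(('a \<Rightarrow> real) \<Rightarrow> real) \<Rightarrow> ('a \<Rightarrow> real) \<Rightarrow> 'a \<Rightarrow> real" where
  "grad_coord \<xi> l z = deriv (\<lambda>t. \<xi> (l(z := t))) (l z)"

definition G_op :: "('a::euclidean_space \<Rightarrow> ereal) \<Rightarrow> 'a set \<Rightarrow> ('a \<Rightarrow> real) \<Rightarrow> ('a \<Rightarrow>\<^sub>L real)" where
  "G_op f Z l = (\<Sum>z\<in>Z. l z *\<^sub>R grad f z)"

definition f_star :: "('a::euclidean_space \<Rightarrow> ereal) \<Rightarrow> 'a \<Rightarrow> real" where
  "f_star f z = blinfun_apply (grad f z) z - real_of_ereal (f z)"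

definition xi ::
    "('a::euclidean_space \<Rightarrow> ereal) \<Rightarrow> ('a \<Rightarrow> ereal) \<Rightarrow> ('a \<Rightarrow> ereal) \<Rightarrow> real \<Rightarrow>
     'a \<Rightarrow> 'a set \<Rightarrow> ('a \<Rightarrow> real) \<Rightarrow> real" where
  "xi d f \<psi> L xbar Z l =
     Phi d \<psi> L (L *\<^sub>R grad d xbar - G_op f Z l) + (\<Sum>z\<in>Z. l z * f_star f z)
       + L * (real_of_ereal (d xbar) - blinfun_apply (grad d xbar) xbar)"

text \<open>
  The multipliers of an inexact iteration are not determined by its data, so an iteration is a
  relation between the current point \<open>xbar\<close> and a possible output \<open>xnew\<close>.
\<close>

definition inexact_step ::
    "('a::euclidean_space \<Rightarrow> ereal) \<Rightarrow> ('a \<Rightarrow> ereal) \<Rightarrow> ('a \<Rightarrow> ereal) \<Rightarrow> real \<Rightarrow> real \<Rightarrow>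
     'a \<Rightarrow> 'a set \<Rightarrow> 'a \<Rightarrow> bool" where
  "inexact_step d f \<psi> L \<delta> xbar Z xnew \<longleftrightarrow>
     (\<exists>lbar \<in> std_simplex Z.
        (\<forall>l \<in> std_simplex Z.
           (\<Sum>z\<in>Z. (lbar z - l z) * grad_coord (xi d f \<psi> L xbar Z) lbar z) \<le> \<delta>) \<and>
        xnew = ystar d \<psi> L (L *\<^sub>R grad d xbar - G_op f Z lbar))"

definition igmm ::
    "('a::euclidean_space \<Rightarrow> ereal) \<Rightarrow> ('a \<Rightarrow> ereal) \<Rightarrow> ('a \<Rightarrow> ereal) \<Rightarrow> real \<Rightarrow> real \<Rightarrow>
     (nat \<Rightarrow> 'a set) \<Rightarrow> (nat \<Rightarrow> 'a) \<Rightarrow> bool" where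
  "igmm d f \<psi> L \<delta> Z x \<longleftrightarrow>
     (\<forall>k. finite (Z k) \<and> Z k \<subseteq> edom \<psi> \<and> x k \<in> Z k \<and>
          inexact_step d f \<psi> L \<delta> (x k) (Z k) (x (Suc k)))"

end

theory Submission
  imports Defs
begin

text \<open>
  One step replaces \<open>f\<close> by a convex combination of its linearizations at the points of \<open>Z\<close> and adds
  \<open>L\<close> times the Bregman distance from the current point \<open>xbar\<close> as well as \<open>\<psi>\<close>.  For fixed multipliers this
  model is, up to a constant and a sign, the objective that defines \<open>Phi\<close>
  (\<open>model_eq_dual_objective\<close>), so the new point is the exact minimizer of the model.  Three facts give the rate.

  \<^item> The linearizations lie below \<open>f\<close>, so the model at any \<open>y\<close> is at most
    \<open>F y + L * bregman d xbar y\<close>.  As the model is \<open>L\<close>-strongly convex relative to \<open>d\<close>, its minimal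
    value is smaller still by \<open>L * bregman d xnew y\<close> (\<open>dual_objective_three_point\<close>).

  \<^item> The linearization at \<open>xbar\<close> alone, together with the Bregman term, lies above \<open>f\<close>, because
    \<open>L\<close> is at least the relative smoothness constant.

  \<^item> The stopping criterion bounds what is lost by passing from the single linearization at \<open>xbar\<close> to
    the combination: at the new point the former exceeds the latter by at most \<open>\<delta>\<close>
    (\<open>inexact_step_model_gap\<close>).

  Together they show that \<open>F xnew + L * bregman d xnew y\<close> is at most
  \<open>F y + L * bregman d xbar y + \<delta>\<close> (\<open>inexact_step_descent\<close>), and the Bregman terms
  telescope over the iterations.

  The third fact depends on the partial derivatives of \<open>xi\<close>, hence on the differentiability of \<open>Phi\<close>.
  This is an envelope theorem: along a line, a difference quotient of \<open>Phi\<close> lies between the values of the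
  direction at the two maximizers, and maximizers depend continuously on the functional.  Continuity
  follows by compactness: the maximizers stay bounded because \<open>Phi\<close> is finite everywhere, each of
  their cluster points is a maximizer because the epigraph is closed, and strict convexity of \<open>d\<close> makes the maximizer
  unique.
\<close>

section \<open>Extended-valued convex functions and Bregman distances\<close>

lemma ereal_real_edom:
  assumes "closed_convex h" "u \<in> edom h"
  shows "h u = ereal (real_of_ereal (h u))"
  using assms unfolding closed_convex_def edom_def by (cases "h u") auto

lemma closed_convex_segment:
  assumes h: "closed_convex h" and uv: "u \<in> edom h" "v \<in> edom h" and t: "0 \<le> t" "t \<le> 1"
  shows "(1 - t) *\<^sub>R u + t *\<^sub>R v \<in> edom h"
    and "real_of_ereal (h ((1 - t) *\<^sub>R u + t *\<^sub>R v))
           \<le> (1 - t) * real_of_ereal (h u) + t * real_of_ereal (h v)"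
proof -
  let ?w = "(1 - t) *\<^sub>R u + t *\<^sub>R v"
  let ?r = "(1 - t) * real_of_ereal (h u) + t * real_of_ereal (h v)"
  have "convex {(x, t :: real). h x \<le> ereal t}"
    using h by (simp add: closed_convex_def)
  moreover have "(u, real_of_ereal (h u)) \<in> {(x, t :: real). h x \<le> ereal t}"
      "(v, real_of_ereal (h v)) \<in> {(x, t :: real). h x \<le> ereal t}"
    using ereal_real_edom[OF h] uv by (metis (mono_tags, lifting) case_prodI mem_Collect_eq order_refl)+
  ultimately have "(1 - t) *\<^sub>R (u, real_of_ereal (h u)) + t *\<^sub>R (v, real_of_ereal (h v))
      \<in> {(x, t :: real). h x \<le> ereal t}"
    by (rule convexD) (use t in auto)
  then have le: "h ?w \<le> ereal ?r"
    by simp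
  then show "?w \<in> edom h"
    unfolding edom_def using le_less_trans by fastforce
  from ereal_real_edom[OF h this] le show "real_of_ereal (h ?w) \<le> ?r"
    by (metis ereal_less_eq(3))
qed

lemma closed_convex_eventually_greater:
  assumes h: "closed_convex h" and a: "ereal a < h u" and X: "X \<longlonglongrightarrow> u"
  shows "\<forall>\<^sub>F n in sequentially. ereal a < h (X n)"
proof -
  have "closed ((\<lambda>x. (x, a)) -` {(x, t :: real). h x \<le> ereal t})"
    using h by (intro closed_vimage continuous_intros) (simp add: closed_convex_def)
  then have "open (- ((\<lambda>x. (x, a)) -` {(x, t :: real). h x \<le> ereal t}))"
    by (simp add: open_Compl)
  moreover have "- ((\<lambda>x. (x, a)) -` {(x, t :: real). h x \<le> ereal t}) = {x. ereal a < h x}"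
    by auto
  ultimately have "open {x. ereal a < h x}" by simp
  from topological_tendstoD[OF X this] a show ?thesis by simp
qed

lemma has_derivative_grad:
  assumes "differentiable_at h u"
  shows "((\<lambda>y. real_of_ereal (h y)) has_derivative blinfun_apply (grad h u)) (at u)"
proof -
  have D: "((\<lambda>y. real_of_ereal (h y)) has_derivative
      frechet_derivative (\<lambda>y. real_of_ereal (h y)) (at u)) (at u)"
    using assms by (simp add: differentiable_at_def frechet_derivative_works)
  then show ?thesis
    unfolding grad_def by (simp add: bounded_linear_Blinfun_apply has_derivative_bounded_linear)
qed

lemma bregman_pos:
  assumes d: "prox_function d" and u: "u \<in> interior (edom d)" and v: "v \<in> edom d" and "u \<noteq> v"
  shows "0 < bregman d u v"
proof -
  have cc: "closed_convex d" using d by (simp add: prox_function_def)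
  have "d u + ereal (blinfun_apply (grad d u) (v - u)) < d v"
    using assms by (auto simp: prox_function_def)
  moreover obtain a b where "d u = ereal a" "d v = ereal b"
    using ereal_real_edom[OF cc] u v interior_subset by blast
  ultimately show ?thesis by (simp add: bregman_def)
qed

lemma bregman_nonneg:
  assumes d: "prox_function d" and u: "u \<in> interior (edom d)" and v: "v \<in> edom d"
  shows "0 \<le> bregman d u v"
  using bregman_pos[OF assms] by (cases "u = v") (auto simp: bregman_def)

text \<open>
  Lower semicontinuity is applied to each summand separately, because a limit point of the domain of \<open>p\<close> may leave the
  domain of \<open>d\<close>.  Real lower bounds \<open>a < d u\<close> and \<open>b < p u\<close>, valid along the
  whole tail of the sequence, avoid sums of infinite values.
\<close>
lemma closed_epigraph_weighted_sum:
  assumes d: "closed_convex d" and p: "closed_convex p" and sub: "edom p \<subseteq> edom d" and L: "0 < L"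
  shows "closed {(u, t). u \<in> edom p \<and> L * real_of_ereal (d u) + real_of_ereal (p u) \<le> t}"
proof -
  have "u \<in> edom p \<and> L * real_of_ereal (d u) + real_of_ereal (p u) \<le> t"
    if X: "\<And>n. X n \<in> edom p \<and> L * real_of_ereal (d (X n)) + real_of_ereal (p (X n)) \<le> c n"
      and lim: "X \<longlonglongrightarrow> u" "c \<longlonglongrightarrow> t" for X c u t
  proof -
    have low: "L * a + b \<le> t" if a: "ereal a < d u" and b: "ereal b < p u" for a b
    proof (rule tendsto_lowerbound[OF lim(2)])
      show "\<forall>\<^sub>F n in sequentially. L * a + b \<le> c n"
        using closed_convex_eventually_greater[OF d a lim(1)]
          closed_convex_eventually_greater[OF p b lim(1)]
      proof eventually_elim
        case (elim n)
        have "X n \<in> edom p" "X n \<in> edom d" using X sub by auto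
        then have "a < real_of_ereal (d (X n))" "b < real_of_ereal (p (X n))"
          using elim ereal_real_edom[OF d] ereal_real_edom[OF p] by (metis less_ereal.simps(1))+
        moreover from this have "L * a \<le> L * real_of_ereal (d (X n))"
          using L by simp
        ultimately show ?case using X[of n] by linarith
      qed
    qed simp
    have "- \<infinity> < d u" "- \<infinity> < p u"
      using d p by (auto simp: closed_convex_def)
    then obtain a0 where a0: "ereal a0 < d u" using ereal_dense2 by blast
    \<comment> \<open>If \<open>p u\<close> were infinite, \<open>b\<close> could be taken so large that the bound exceeds \<open>t\<close> by one.\<close>
    have u: "u \<in> edom p"
    proof (rule ccontr)
      assume "u \<notin> edom p"
      then have "p u = \<infinity>" by (simp add: edom_def)
      then have "L * a0 + (t + 1 - L * a0) \<le> t" by (intro low a0) simp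
      then show False by simp
    qed
    moreover obtain D P where DP: "d u = ereal D" "p u = ereal P"
      using u sub ereal_real_edom[OF d] ereal_real_edom[OF p] by blast
    have "L * D + P \<le> t + e" if "e > 0" for e
    proof -
      have "L * (D - e / (2 * L)) + (P - e / 2) \<le> t"
        using L that by (intro low) (auto simp: DP)
      moreover have "L * (D - e / (2 * L)) = L * D - e / 2"
        using L by (simp only: right_diff_distrib) simp
      ultimately show ?thesis by linarith
    qed
    then have "L * D + P \<le> t" by (rule field_le_epsilon)
    ultimately show ?thesis by (simp add: DP)
  qed
  note limit = this
  show ?thesis
    unfolding closed_sequential_limits
  proof (intro allI impI, elim conjE)
    fix Q and q :: "'a \<times> real"
    assume Q: "\<forall>n. Q n \<in> {(u, t). u \<in> edom p \<and> L * real_of_ereal (d u) + real_of_ereal (p u) \<le> t}"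
      and q: "Q \<longlonglongrightarrow> q"
    show "q \<in> {(u, t). u \<in> edom p \<and> L * real_of_ereal (d u) + real_of_ereal (p u) \<le> t}"
      using limit[of "\<lambda>n. fst (Q n)" "\<lambda>n. snd (Q n)" "fst q" "snd q"]
        tendsto_fst[OF q] tendsto_snd[OF q] Q by (auto simp: split_beta)
  qed
qed

section \<open>Differentiability of a maximum of affine functions\<close>

text \<open>
  The maximizers on the segment stay bounded because the maximum is attained for every functional: the
  values at \<open>s + h + q\<close> and \<open>s - h + q\<close> control \<open>q\<close> at all maximizers for functionals
  between \<open>s - h\<close> and \<open>s + h\<close>.  A cluster point is then a maximizer for \<open>s\<close>, so it is \<open>Y s\<close>.
\<close>
lemma maximizer_along_line_tendsto:
  fixes Y :: "('a::euclidean_space \<Rightarrow>\<^sub>L real) \<Rightarrow> 'a" and H :: "'a \<Rightarrow> real"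
  assumes closed: "closed {(u, t). u \<in> S \<and> H u \<le> t}"
    and Y: "\<And>s. Y s \<in> S"
    and Y_max: "\<And>s u. u \<in> S \<Longrightarrow> blinfun_apply s u - H u \<le> blinfun_apply s (Y s) - H (Y s)"
    and unique: "\<And>u. u \<in> S \<Longrightarrow>
        (\<And>v. v \<in> S \<Longrightarrow> blinfun_apply s v - H v \<le> blinfun_apply s u - H u) \<Longrightarrow> u = Y s"
  shows "((\<lambda>t. Y (s + t *\<^sub>R h)) \<longlongrightarrow> Y s) (at 0)"
proof (rule ccontr)
  let ?V = "\<lambda>s. blinfun_apply s (Y s) - H (Y s)"
  assume "\<not> ?thesis"
  then obtain e where e: "e > 0"
    and far: "\<And>r. r > 0 \<Longrightarrow> \<exists>t. \<bar>t\<bar> < r \<and> dist (Y (s + t *\<^sub>R h)) (Y s) \<ge> e"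
    unfolding LIM_def by (metis dist_real_def diff_zero not_le_imp_less)
  have "\<exists>t. \<forall>n. \<bar>t n\<bar> < inverse (real (Suc n)) \<and> dist (Y (s + t n *\<^sub>R h)) (Y s) \<ge> e"
    by (intro choice allI far) simp
  then obtain t where t: "\<And>n. \<bar>t n\<bar> < inverse (real (Suc n))"
    and t_far: "\<And>n. dist (Y (s + t n *\<^sub>R h)) (Y s) \<ge> e" by blast
  have t0: "t \<longlonglongrightarrow> 0"
    by (rule Lim_null_comparison[OF _ LIMSEQ_inverse_real_of_nat])
      (use t in \<open>auto intro!: always_eventually less_imp_le\<close>)
  have t1: "\<bar>t n\<bar> \<le> 1" for n
    using t[of n] by (smt (verit) inverse_le_1_iff of_nat_Suc of_nat_0_le_iff)
  \<comment> \<open>For a maximizer \<open>u\<close> at \<open>s + r *\<^sub>R h\<close>, adding \<open>q\<close> to the functional raises the maximum by at least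
    \<open>q u\<close>.  The objective at \<open>u\<close> is affine in \<open>r\<close>, hence below the larger of its values at
    \<open>r = 1\<close> and \<open>r = -1\<close>; the competitor \<open>Y s\<close> bounds the maximum from below.\<close>
  have bound: "blinfun_apply q (Y (s + r *\<^sub>R h))
      \<le> \<bar>?V (s + h + q)\<bar> + \<bar>?V (s - h + q)\<bar> + \<bar>blinfun_apply h (Y s)\<bar> - ?V s"
    if r: "\<bar>r\<bar> \<le> 1" for q r
  proof -
    let ?u = "Y (s + r *\<^sub>R h)"
    have up: "blinfun_apply (s + h + q) ?u - H ?u \<le> ?V (s + h + q)"
        "blinfun_apply (s - h + q) ?u - H ?u \<le> ?V (s - h + q)"
      by (intro Y_max Y)+
    have "blinfun_apply (s + r *\<^sub>R h) (Y s) - H (Y s) \<le> blinfun_apply (s + r *\<^sub>R h) ?u - H ?u"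
      by (intro Y_max Y)
    then have low: "blinfun_apply s ?u + r * blinfun_apply h ?u - H ?u
        \<ge> ?V s + r * blinfun_apply h (Y s)"
      by (simp add: blinfun.bilinear_simps)
    have abs: "\<bar>r * w\<bar> \<le> \<bar>w\<bar>" for w
      using mult_right_mono[OF r abs_ge_zero[of w]] by (simp add: abs_mult)
    show ?thesis
      using up low abs[of "blinfun_apply h (Y s)"] abs[of "blinfun_apply h ?u"]
      by (simp add: blinfun.bilinear_simps)
  qed
  \<comment> \<open>Plus and minus the coordinate functionals, as \<open>q\<close>, bound every coordinate.\<close>
  have "bounded (range (\<lambda>n. Y (s + t n *\<^sub>R h)))"
  proof -
    define C where "C q = \<bar>?V (s + h + q)\<bar> + \<bar>?V (s - h + q)\<bar> + \<bar>blinfun_apply h (Y s)\<bar> - ?V s" for q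
    have "norm (Y (s + t n *\<^sub>R h))
        \<le> (\<Sum>b\<in>Basis. \<bar>C (blinfun_inner_left b)\<bar> + \<bar>C (- blinfun_inner_left b)\<bar>)" for n
    proof -
      have "\<bar>Y (s + t n *\<^sub>R h) \<bullet> b\<bar> \<le> \<bar>C (blinfun_inner_left b)\<bar> + \<bar>C (- blinfun_inner_left b)\<bar>" for b
        using bound[OF t1, of "blinfun_inner_left b" n] bound[OF t1, of "- blinfun_inner_left b" n]
        unfolding C_def[symmetric] by (simp add: blinfun.bilinear_simps inner_commute)
      then show ?thesis
        by (intro order_trans[OF norm_le_l1] sum_mono)
    qed
    then show ?thesis by (auto simp: bounded_iff)
  qed
  from bounded_imp_convergent_subsequence[OF this] obtain u \<sigma>
    where \<sigma>: "strict_mono \<sigma>" and u: "(\<lambda>n. Y (s + t (\<sigma> n) *\<^sub>R h)) \<longlonglongrightarrow> u"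
    unfolding o_def by auto
  have t\<sigma>: "(\<lambda>n. t (\<sigma> n)) \<longlonglongrightarrow> 0"
    using LIMSEQ_subseq_LIMSEQ[OF t0 \<sigma>] by (simp add: o_def)
  \<comment> \<open>Maximality against \<open>v\<close> puts the points \<open>(Y (?s n), ?c n)\<close> into the epigraph, so their limit is there
    too.\<close>
  have lim: "u \<in> S \<and> H u \<le> blinfun_apply s u - (blinfun_apply s v - H v)" if v: "v \<in> S" for v
  proof -
    let ?s = "\<lambda>n. s + t (\<sigma> n) *\<^sub>R h"
    let ?c = "\<lambda>n. blinfun_apply (?s n) (Y (?s n)) - (blinfun_apply (?s n) v - H v)"
    have "(\<lambda>n. (Y (?s n), ?c n)) \<longlonglongrightarrow>
        (u, blinfun_apply (s + 0 *\<^sub>R h) u - (blinfun_apply (s + 0 *\<^sub>R h) v - H v))"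
      by (intro tendsto_intros u t\<sigma>)
    moreover have "(Y (?s n), ?c n) \<in> {(u, t). u \<in> S \<and> H u \<le> t}" for n
      using Y_max[OF v, of "?s n"] Y[of "?s n"] by simp
    ultimately have "(u, blinfun_apply (s + 0 *\<^sub>R h) u - (blinfun_apply (s + 0 *\<^sub>R h) v - H v))
        \<in> {(u, t). u \<in> S \<and> H u \<le> t}"
      by (rule closed_sequentially[OF closed, rotated])
    then show ?thesis by simp
  qed
  have "u = Y s"
  proof (rule unique)
    show "u \<in> S" using lim[OF Y] by simp
    show "blinfun_apply s v - H v \<le> blinfun_apply s u - H u" if "v \<in> S" for v
      using lim[OF that] by simp
  qed
  moreover have "e \<le> dist u (Y s)"
    by (rule tendsto_lowerbound[OF tendsto_dist[OF u tendsto_const]]) (simp_all add: t_far)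
  ultimately show False using e by simp
qed

text \<open>
  Comparing each of the maximizers at \<open>s\<close> and \<open>s + t *\<^sub>R h\<close> with the other one squeezes the
  difference quotient between \<open>h\<close> at \<open>Y s\<close> and \<open>h\<close> at \<open>Y (s + t *\<^sub>R h)\<close>.
\<close>
lemma max_value_has_derivative_along_line:
  fixes Y :: "('a::euclidean_space \<Rightarrow>\<^sub>L real) \<Rightarrow> 'a" and H :: "'a \<Rightarrow> real"
  assumes closed: "closed {(u, t). u \<in> S \<and> H u \<le> t}"
    and Y: "\<And>s. Y s \<in> S"
    and Y_max: "\<And>s u. u \<in> S \<Longrightarrow> blinfun_apply s u - H u \<le> blinfun_apply s (Y s) - H (Y s)"
    and unique: "\<And>u. u \<in> S \<Longrightarrow>
        (\<And>v. v \<in> S \<Longrightarrow> blinfun_apply s v - H v \<le> blinfun_apply s u - H u) \<Longrightarrow> u = Y s"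
  defines "V \<equiv> \<lambda>s. blinfun_apply s (Y s) - H (Y s)"
  shows "((\<lambda>t. V (s + t *\<^sub>R h)) has_real_derivative blinfun_apply h (Y s)) (at 0)"
  unfolding DERIV_def
proof (rule LIM_zero_cancel, rule Lim_null_comparison)
  let ?Y = "\<lambda>t. Y (s + t *\<^sub>R h)"
  have "((\<lambda>t. blinfun_apply h (?Y t)) \<longlongrightarrow> blinfun_apply h (Y s)) (at 0)"
    by (intro tendsto_intros maximizer_along_line_tendsto[OF closed Y Y_max unique])
  then show "((\<lambda>t. \<bar>blinfun_apply h (?Y t) - blinfun_apply h (Y s)\<bar>) \<longlongrightarrow> 0) (at 0)"
    by (intro tendsto_rabs_zero LIM_zero)
  show "\<forall>\<^sub>F t in at 0. norm ((V (s + (0 + t) *\<^sub>R h) - V (s + 0 *\<^sub>R h)) / t - blinfun_apply h (Y s))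
      \<le> \<bar>blinfun_apply h (?Y t) - blinfun_apply h (Y s)\<bar>"
    using eventually_neq_at_within[of 0]
  proof (rule eventually_mono)
    fix t :: real assume t: "t \<noteq> 0"
    have "t * blinfun_apply h (Y s) \<le> V (s + t *\<^sub>R h) - V s"
      using Y_max[OF Y, of "s + t *\<^sub>R h" s] by (simp add: V_def blinfun.bilinear_simps)
    moreover have "V (s + t *\<^sub>R h) - V s \<le> t * blinfun_apply h (?Y t)"
      using Y_max[OF Y, of s "s + t *\<^sub>R h"] by (simp add: V_def blinfun.bilinear_simps)
    ultimately have "\<bar>V (s + t *\<^sub>R h) - V s - t * blinfun_apply h (Y s)\<bar>
        \<le> \<bar>t * (blinfun_apply h (?Y t) - blinfun_apply h (Y s))\<bar>"
      by (simp add: algebra_simps)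
    moreover have "V (s + t *\<^sub>R h) - V s - t * blinfun_apply h (Y s)
        = t * ((V (s + t *\<^sub>R h) - V s) / t - blinfun_apply h (Y s))"
      using t by (simp add: right_diff_distrib[of t "_ / t"])
    ultimately have "\<bar>t\<bar> * \<bar>(V (s + t *\<^sub>R h) - V s) / t - blinfun_apply h (Y s)\<bar>
        \<le> \<bar>t\<bar> * \<bar>blinfun_apply h (?Y t) - blinfun_apply h (Y s)\<bar>"
      by (simp only: abs_mult)
    then show "norm ((V (s + (0 + t) *\<^sub>R h) - V (s + 0 *\<^sub>R h)) / t - blinfun_apply h (Y s))
      \<le> \<bar>blinfun_apply h (?Y t) - blinfun_apply h (Y s)\<bar>"
      using t by simp
  qed
qed

section \<open>The dual objective and the derivative of its maximum\<close>

lemma is_arg_max_iff: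
  fixes g :: "'a \<Rightarrow> real"
  shows "is_arg_max g P u \<longleftrightarrow> P u \<and> (\<forall>v. P v \<longrightarrow> g v \<le> g u)"
  by (auto simp: is_arg_max_def not_less)

text \<open>
  At the midpoint of two maximizers the objective would be strictly larger.  The strict gradient
  inequality applies there because the midpoint stays in the domain of \<open>p\<close>, hence in the
  interior of the domain of \<open>d\<close>.
\<close>
lemma dual_objective_maximizer_unique:
  assumes d: "prox_function d" and p: "closed_convex p" and sub: "edom p \<subseteq> interior (edom d)"
    and L: "0 < L"
    and u: "is_arg_max (dual_objective d p L s) (\<lambda>u. u \<in> edom p) u"
    and v: "is_arg_max (dual_objective d p L s) (\<lambda>u. u \<in> edom p) v"
  shows "u = v"
proof (rule ccontr)
  assume "u \<noteq> v"
  define m where "m = (1 - 1/2) *\<^sub>R u + (1/2 :: real) *\<^sub>R v"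
  let ?d = "\<lambda>u. real_of_ereal (d u)" and ?p = "\<lambda>u. real_of_ereal (p u)"
  have uv: "u \<in> edom p" "v \<in> edom p" using u v by (auto simp: is_arg_max_def)
  have m: "m \<in> edom p" and pm: "2 * ?p m \<le> ?p u + ?p v"
    unfolding m_def using closed_convex_segment[OF p uv, of "1/2"] by auto
  have um: "u - m = (1/2 :: real) *\<^sub>R (u - v)" and vm: "v - m = - (u - m)"
    unfolding m_def by (auto simp: algebra_simps simp flip: scaleR_add_left)
  have "m \<noteq> u" "m \<noteq> v" using um vm \<open>u \<noteq> v\<close> by auto
  then have "0 < bregman d m u" "0 < bregman d m v"
    using bregman_pos[OF d] m uv sub interior_subset by blast+
  then have "2 * ?d m < ?d u + ?d v"
    unfolding bregman_def vm by (simp add: blinfun.bilinear_simps)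
  from mult_strict_left_mono[OF this L] have "2 * (L * ?d m) < L * ?d u + L * ?d v"
    by (simp add: algebra_simps)
  moreover have "dual_objective d p L s m \<le> dual_objective d p L s u"
      "dual_objective d p L s m \<le> dual_objective d p L s v"
    using u v m by (auto simp: is_arg_max_iff)
  moreover have "2 * blinfun_apply s m = blinfun_apply s u + blinfun_apply s v"
    unfolding m_def by (simp add: blinfun.bilinear_simps)
  ultimately show False
    using pm unfolding dual_objective_def by linarith
qed

lemma ystar_is_arg_max:
  assumes "\<exists>v. is_arg_max (dual_objective d p L s) (\<lambda>u. u \<in> edom p) v"
  shows "is_arg_max (dual_objective d p L s) (\<lambda>u. u \<in> edom p) (ystar d p L s)"
  using assms unfolding ystar_def arg_max_def by (rule someI_ex)

lemma Phi_eq_dual_objective_ystar: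
  assumes "\<exists>v. is_arg_max (dual_objective d p L s) (\<lambda>u. u \<in> edom p) v"
  shows "Phi d p L s = dual_objective d p L s (ystar d p L s)"
  unfolding Phi_def
  by (rule cSup_eq_maximum) (use ystar_is_arg_max[OF assms] in \<open>auto simp: is_arg_max_iff\<close>)

lemma Phi_has_derivative_along_line:
  assumes d: "prox_function d" and p: "closed_convex p" and sub: "edom p \<subseteq> interior (edom d)"
    and L: "0 < L"
    and att: "\<And>s. \<exists>v. is_arg_max (dual_objective d p L s) (\<lambda>u. u \<in> edom p) v"
  shows "((\<lambda>t. Phi d p L (s + t *\<^sub>R h)) has_real_derivative blinfun_apply h (ystar d p L s)) (at 0)"
proof -
  define H where "H u = L * real_of_ereal (d u) + real_of_ereal (p u)" for u
  have obj: "dual_objective d p L s u = blinfun_apply s u - H u" for s u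
    by (simp add: dual_objective_def H_def)
  have "edom p \<subseteq> edom d" using sub interior_subset by blast
  with d p L have closed: "closed {(u, t). u \<in> edom p \<and> H u \<le> t}"
    unfolding H_def by (intro closed_epigraph_weighted_sum) (auto simp: prox_function_def)
  note max = ystar_is_arg_max[OF att, unfolded is_arg_max_iff obj]
  have "((\<lambda>t. blinfun_apply (s + t *\<^sub>R h) (ystar d p L (s + t *\<^sub>R h)) - H (ystar d p L (s + t *\<^sub>R h)))
      has_real_derivative blinfun_apply h (ystar d p L s)) (at 0)"
  proof (rule max_value_has_derivative_along_line[OF closed])
    show "ystar d p L s \<in> edom p" for s using max by blast
    show "blinfun_apply s u - H u \<le> blinfun_apply s (ystar d p L s) - H (ystar d p L s)"
      if "u \<in> edom p" for s u using max that by blast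
    show "u = ystar d p L s" if "u \<in> edom p"
      "\<And>v. v \<in> edom p \<Longrightarrow> blinfun_apply s v - H v \<le> blinfun_apply s u - H u" for u
      by (rule dual_objective_maximizer_unique[OF d p sub L _ ystar_is_arg_max[OF att]])
        (use that in \<open>auto simp: is_arg_max_iff obj\<close>)
  qed
  then show ?thesis
    by (simp add: Phi_eq_dual_objective_ystar[OF att] obj)
qed

section \<open>The stopping criterion in terms of linearizations\<close>

lemma G_op_fun_upd:
  assumes "finite Z" "z \<in> Z"
  shows "G_op f Z (l(z := t)) = G_op f Z l + (t - l z) *\<^sub>R grad f z"
proof -
  have "(\<Sum>u\<in>Z - {z}. (l(z := t)) u *\<^sub>R grad f u) = (\<Sum>u\<in>Z - {z}. l u *\<^sub>R grad f u)"
    by (rule sum.cong) auto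
  then show ?thesis
    using assms by (simp add: G_op_def sum.remove[of Z z] algebra_simps)
qed

lemma sum_mult_fun_upd:
  fixes c :: "'a \<Rightarrow> real"
  assumes "finite Z" "z \<in> Z"
  shows "(\<Sum>u\<in>Z. (l(z := t)) u * c u) = (\<Sum>u\<in>Z. l u * c u) + (t - l z) * c z"
proof -
  have "(\<Sum>u\<in>Z - {z}. (l(z := t)) u * c u) = (\<Sum>u\<in>Z - {z}. l u * c u)"
    by (rule sum.cong) auto
  then show ?thesis
    using assms by (simp add: sum.remove[of Z z] algebra_simps)
qed

definition linearization :: "('a::euclidean_space \<Rightarrow> ereal) \<Rightarrow> 'a \<Rightarrow> 'a \<Rightarrow> real" where
  "linearization f z u = real_of_ereal (f z) + blinfun_apply (grad f z) (u - z)"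

text \<open>
  Moving the multiplier of \<open>z\<close> moves the functional inside \<open>Phi\<close> along the line with direction
  \<open>- grad f z\<close>; the derivative of \<open>Phi\<close> evaluates this direction at the maximizer, and the linear
  term \<open>f_star f z\<close> supplies the constant of the linearization.
\<close>
lemma grad_coord_xi:
  assumes d: "prox_function d" and p: "closed_convex p" and sub: "edom p \<subseteq> interior (edom d)"
    and L: "0 < L"
    and att: "\<And>s. \<exists>v. is_arg_max (dual_objective d p L s) (\<lambda>u. u \<in> edom p) v"
    and Z: "finite Z" "z \<in> Z"
  shows "grad_coord (xi d f p L xbar Z) l z
      = - linearization f z (ystar d p L (L *\<^sub>R grad d xbar - G_op f Z l))"
proof -
  let ?s = "L *\<^sub>R grad d xbar - G_op f Z l"
  let ?K = "(\<Sum>u\<in>Z. l u * f_star f u) + L * (real_of_ereal (d xbar) - blinfun_apply (grad d xbar) xbar)"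
  have "((\<lambda>t. Phi d p L (?s + t *\<^sub>R (- grad f z)) + t * f_star f z + ?K) has_real_derivative
      blinfun_apply (- grad f z) (ystar d p L ?s) + f_star f z) (at 0)"
    by (rule derivative_eq_intros Phi_has_derivative_along_line[OF d p sub L att] refl)+ simp
  then have "((\<lambda>t. Phi d p L (?s + (t + - l z) *\<^sub>R (- grad f z)) + (t + - l z) * f_star f z + ?K)
      has_real_derivative blinfun_apply (- grad f z) (ystar d p L ?s) + f_star f z) (at (l z))"
    by (intro iffD1[OF DERIV_shift]) simp
  moreover have "xi d f p L xbar Z (l(z := t))
      = Phi d p L (?s + (t + - l z) *\<^sub>R (- grad f z)) + (t + - l z) * f_star f z + ?K" for t
    unfolding xi_def G_op_fun_upd[OF Z] sum_mult_fun_upd[OF Z]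
    by (simp add: algebra_simps)
  ultimately have "((\<lambda>t. xi d f p L xbar Z (l(z := t)))
      has_real_derivative blinfun_apply (- grad f z) (ystar d p L ?s) + f_star f z) (at (l z))"
    by simp
  from DERIV_imp_deriv[OF this] show ?thesis
    by (simp add: grad_coord_def linearization_def f_star_def blinfun.bilinear_simps)
qed

section \<open>Progress of one inexact step\<close>

text \<open>
  The objective is maximal at \<open>u\<close> along the segment towards \<open>y\<close>.  Only \<open>d\<close> is differentiable, so
  the difference quotient of \<open>p\<close> is replaced by its convexity bound \<open>p y - p u\<close>; the resulting first-order
  condition at \<open>u\<close> differs from the claim exactly by \<open>L\<close> times the Bregman remainder of \<open>d\<close>.
\<close>
lemma dual_objective_three_point:
  assumes d: "prox_function d" and p: "closed_convex p" and sub: "edom p \<subseteq> interior (edom d)"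
    and L: "0 < L"
    and u: "is_arg_max (dual_objective d p L s) (\<lambda>u. u \<in> edom p) u" and y: "y \<in> edom p"
  shows "dual_objective d p L s y + L * bregman d u y \<le> dual_objective d p L s u"
proof -
  let ?d = "\<lambda>u. real_of_ereal (d u)" and ?p = "\<lambda>u. real_of_ereal (p u)"
  have u_dom: "u \<in> edom p" using u by (simp add: is_arg_max_iff)
  then have "differentiable_at d u" using d sub by (auto simp: prox_function_def)
  from has_derivative_grad[OF this]
  have "((\<lambda>t. ?d (u + t *\<^sub>R (y - u))) has_derivative
      (\<lambda>t. blinfun_apply (grad d u) (t *\<^sub>R (y - u)))) (at (0::real))"
    by (intro has_derivative_compose[where g = ?d and f = "\<lambda>t. u + t *\<^sub>R (y - u)" and s = UNIV])
      (auto intro!: derivative_eq_intros)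
  then have "((\<lambda>t. ?d (u + t *\<^sub>R (y - u))) has_real_derivative
      blinfun_apply (grad d u) (y - u)) (at 0)"
    by (simp add: has_field_derivative_def blinfun.scaleR_right mult.commute[of "blinfun_apply _ _"]
        mult_commute_abs)
  then have "((\<lambda>t. (?d (u + t *\<^sub>R (y - u)) - ?d u) / t) \<longlongrightarrow> blinfun_apply (grad d u) (y - u)) (at 0)"
    by (simp add: DERIV_def)
  then have lim: "((\<lambda>t. L * ((?d (u + t *\<^sub>R (y - u)) - ?d u) / t))
      \<longlongrightarrow> L * blinfun_apply (grad d u) (y - u)) (at_right 0)"
    by (intro tendsto_mult_left) (rule filterlim_mono[OF _ order_refl at_le], auto)
  have "blinfun_apply s (y - u) - (?p y - ?p u) \<le> L * blinfun_apply (grad d u) (y - u)"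
  proof (rule tendsto_lowerbound[OF lim])
    show "\<forall>\<^sub>F t in at_right 0. blinfun_apply s (y - u) - (?p y - ?p u)
        \<le> L * ((?d (u + t *\<^sub>R (y - u)) - ?d u) / t)"
      using eventually_at_right_real[of 0 "1::real"]
    proof (rule eventually_mono)
      show "(0::real) < 1" by simp
      fix t :: real assume "t \<in> {0<..<1}"
      then have t: "0 < t" "t < 1" by auto
      let ?w = "u + t *\<^sub>R (y - u)"
      have w: "(1 - t) *\<^sub>R u + t *\<^sub>R y = ?w" by (simp add: algebra_simps)
      have "?w \<in> edom p" and pw: "?p ?w \<le> (1 - t) * ?p u + t * ?p y"
        using closed_convex_segment[OF p u_dom y, of t] t by (auto simp: w)
      then have "dual_objective d p L s ?w \<le> dual_objective d p L s u"
        using u by (simp add: is_arg_max_iff)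
      then have "t * (blinfun_apply s (y - u) - (?p y - ?p u)) \<le> L * (?d ?w - ?d u)"
        using pw by (simp add: dual_objective_def blinfun.bilinear_simps algebra_simps)
      then show "blinfun_apply s (y - u) - (?p y - ?p u) \<le> L * ((?d ?w - ?d u) / t)"
        using t by (simp add: field_simps)
    qed
  qed simp
  then show ?thesis
    by (simp add: dual_objective_def bregman_def blinfun.bilinear_simps algebra_simps)
qed

text \<open>
  The constant depends on the multipliers and on \<open>xbar\<close>, not on \<open>u\<close>, so a maximizer of the dual
  objective minimizes the model.
\<close>
lemma model_eq_dual_objective:
  assumes "sum l Z = 1"
  shows "(\<Sum>z\<in>Z. l z * linearization f z u) + L * bregman d xbar u + real_of_ereal (p u)
      = (L * (blinfun_apply (grad d xbar) xbar - real_of_ereal (d xbar)) - (\<Sum>z\<in>Z. l z * f_star f z))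
        - dual_objective d p L (L *\<^sub>R grad d xbar - G_op f Z l) u"
proof -
  have "blinfun_apply (G_op f Z l) u = (\<Sum>z\<in>Z. l z * blinfun_apply (grad f z) u)"
    by (simp add: G_op_def blinfun.sum_left blinfun.scaleR_left)
  moreover have "(\<Sum>z\<in>Z. l z * linearization f z u)
      = (\<Sum>z\<in>Z. l z * blinfun_apply (grad f z) u) - (\<Sum>z\<in>Z. l z * f_star f z)"
    by (simp add: linearization_def f_star_def blinfun.bilinear_simps algebra_simps
        flip: sum_subtractf)
  ultimately show ?thesis
    by (simp add: dual_objective_def bregman_def blinfun.bilinear_simps algebra_simps)
qed

lemma indicator_in_std_simplex:
  assumes "finite Z" "z \<in> Z"
  shows "indicator {z} \<in> std_simplex Z"
  using assms by (auto simp: std_simplex_def indicator_def)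

text \<open>
  The stopping criterion is tested against the vertex of the simplex at \<open>z\<close>, where the combination of
  linearizations collapses to the one at \<open>z\<close>.
\<close>
lemma inexact_step_model_gap:
  assumes d: "prox_function d" and p: "closed_convex p" and sub: "edom p \<subseteq> interior (edom d)"
    and L: "0 < L"
    and att: "\<And>s. \<exists>v. is_arg_max (dual_objective d p L s) (\<lambda>u. u \<in> edom p) v"
    and Z: "finite Z" "z \<in> Z"
    and l: "l \<in> std_simplex Z"
    and gap: "\<And>l'. l' \<in> std_simplex Z \<Longrightarrow>
        (\<Sum>w\<in>Z. (l w - l' w) * grad_coord (xi d f p L xbar Z) l w) \<le> \<delta>"
  shows "linearization f z (ystar d p L (L *\<^sub>R grad d xbar - G_op f Z l))
      \<le> (\<Sum>w\<in>Z. l w * linearization f w (ystar d p L (L *\<^sub>R grad d xbar - G_op f Z l))) + \<delta>"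
proof -
  let ?m = "\<lambda>w. linearization f w (ystar d p L (L *\<^sub>R grad d xbar - G_op f Z l))"
  have "(\<Sum>w\<in>Z. (l w - indicator {z} w) * - ?m w) \<le> \<delta>"
    using gap[OF indicator_in_std_simplex[OF Z]]
    by (simp add: grad_coord_xi[OF d p sub L att Z(1)] cong: sum.cong)
  moreover have "(\<Sum>w\<in>Z. indicator {z} w * ?m w) = (\<Sum>w\<in>Z. if w = z then ?m w else 0)"
    by (rule sum.cong) (auto simp: indicator_def)
  moreover have "(\<Sum>w\<in>Z. (l w - indicator {z} w) * - ?m w)
      = (\<Sum>w\<in>Z. indicator {z} w * ?m w) - (\<Sum>w\<in>Z. l w * ?m w)"
    unfolding sum_subtractf[symmetric] by (rule sum.cong) (auto simp: left_diff_distrib)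
  ultimately show ?thesis using Z by simp
qed

text \<open>
  The new point is bounded from above through the linearization at \<open>xbar\<close>, and the comparison point
  \<open>y\<close> from below through all linearizations; the model at its minimizer links the two.
\<close>
lemma inexact_step_descent:
  assumes d: "prox_function d" and p: "closed_convex p"
    and f: "open (edom f)" "edom f \<subseteq> edom d" and pf: "edom p \<subseteq> edom f"
    and bounds: "\<And>u v. u \<in> edom f \<Longrightarrow> v \<in> edom f \<Longrightarrow>
        0 \<le> bregman f u v \<and> bregman f u v \<le> L * bregman d u v"
    and L: "0 < L"
    and att: "\<And>s. \<exists>v. is_arg_max (dual_objective d p L s) (\<lambda>u. u \<in> edom p) v"
    and Z: "finite Z" "Z \<subseteq> edom p" "xbar \<in> Z"
    and step: "inexact_step d f p L \<delta> xbar Z xnew" and y: "y \<in> edom p"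
  shows "real_of_ereal (f xnew) + real_of_ereal (p xnew) + L * bregman d xnew y
      \<le> real_of_ereal (f y) + real_of_ereal (p y) + L * bregman d xbar y + \<delta>"
proof -
  have sub: "edom p \<subseteq> interior (edom d)"
    using interior_maximal[OF f(2,1)] pf by blast
  from step obtain l where l: "l \<in> std_simplex Z"
    and gap: "\<And>l'. l' \<in> std_simplex Z \<Longrightarrow>
        (\<Sum>w\<in>Z. (l w - l' w) * grad_coord (xi d f p L xbar Z) l w) \<le> \<delta>"
    and xnew: "xnew = ystar d p L (L *\<^sub>R grad d xbar - G_op f Z l)"
    unfolding inexact_step_def by blast
  have l_sum: "sum l Z = 1" and l_pos: "\<And>z. z \<in> Z \<Longrightarrow> 0 \<le> l z"
    using l by (auto simp: std_simplex_def)
  let ?s = "L *\<^sub>R grad d xbar - G_op f Z l"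
  let ?model = "\<lambda>u. \<Sum>z\<in>Z. l z * linearization f z u"
  have max: "is_arg_max (dual_objective d p L ?s) (\<lambda>u. u \<in> edom p) xnew"
    unfolding xnew by (rule ystar_is_arg_max[OF att])
  then have xnew_dom: "xnew \<in> edom f" and y_dom: "y \<in> edom f" and xbar_dom: "xbar \<in> edom f"
    using pf y Z by (auto simp: is_arg_max_iff)
  have "real_of_ereal (f xnew) \<le> linearization f xbar xnew + L * bregman d xbar xnew"
    using bounds[OF xbar_dom xnew_dom] by (simp add: bregman_def[of f] linearization_def)
  also have "\<dots> \<le> ?model xnew + \<delta> + L * bregman d xbar xnew"
    using inexact_step_model_gap[OF d p sub L att Z(1,3) l gap] by (simp add: xnew)
  finally have upper: "real_of_ereal (f xnew) \<le> ?model xnew + \<delta> + L * bregman d xbar xnew" .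
  have "?model y \<le> (\<Sum>z\<in>Z. l z * real_of_ereal (f y))"
  proof (intro sum_mono mult_left_mono l_pos)
    fix z assume "z \<in> Z"
    then have "z \<in> edom f" using Z pf by blast
    from bounds[OF this y_dom] show "linearization f z y \<le> real_of_ereal (f y)"
      by (simp add: bregman_def[of f] linearization_def)
  qed
  also have "\<dots> = real_of_ereal (f y)"
    by (simp add: l_sum flip: sum_distrib_right)
  finally have lower: "?model y \<le> real_of_ereal (f y)" .
  show ?thesis
    using upper lower dual_objective_three_point[OF d p sub L max y]
      model_eq_dual_objective[OF l_sum, of f xnew L d xbar p]
      model_eq_dual_objective[OF l_sum, of f y L d xbar p]
    by linarith
qed

section \<open>The rate of convergence\<close>

theorem theorem2:
  fixes d f \<psi> F :: "'a::euclidean_space \<Rightarrow> ereal"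
    and \<mu>\<^sub>d L\<^sub>d L \<delta> :: real
    and Z :: "nat \<Rightarrow> 'a set" and x :: "nat \<Rightarrow> 'a" and x\<^sub>0 xsol y :: 'a and T :: nat
  assumes d: "prox_function d"
    and f: "closed_convex f" "open (edom f)" "edom f \<subseteq> edom d"
      "\<And>u. u \<in> edom f \<Longrightarrow> differentiable_at f u"
    and constants: "0 \<le> \<mu>\<^sub>d" "\<mu>\<^sub>d \<le> L\<^sub>d"
    and relative_bounds: "\<And>u v. u \<in> edom f \<Longrightarrow> v \<in> edom f \<Longrightarrow>
        \<mu>\<^sub>d * bregman d u v \<le> bregman f u v \<and> bregman f u v \<le> L\<^sub>d * bregman d u v"
    and \<psi>: "closed_convex \<psi>" "edom \<psi> \<subseteq> edom f" "interior (edom \<psi>) \<noteq> {}"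
    and F_def: "\<And>u. F u = f u + \<psi> u"
    and solution: "xsol \<in> edom \<psi>" "\<And>u. u \<in> edom \<psi> \<Longrightarrow> F xsol \<le> F u"
    and max_attained: "\<And>M s. M > 0 \<Longrightarrow>
        \<exists>v. is_arg_max (dual_objective d \<psi> M s) (\<lambda>u. u \<in> edom \<psi>) v"
    and params: "\<delta> \<ge> 0" "L > 0" "L \<ge> L\<^sub>d"
    and start: "x\<^sub>0 \<in> interior (edom \<psi>)" "x 0 = x\<^sub>0"
    and iterates: "igmm d f \<psi> L \<delta> Z x"
    and T: "T \<ge> 1"
    and y: "y \<in> edom \<psi>"
  shows "ereal (1 / real T) * (\<Sum>k=1..T. F (x k))
           \<le> F y + ereal (L / real T * bregman d x\<^sub>0 y) + ereal \<delta>"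
proof -
  have dcc: "closed_convex d" using d by (simp add: prox_function_def)
  let ?F = "\<lambda>u. real_of_ereal (f u) + real_of_ereal (\<psi> u)"
  have F_real: "F u = ereal (?F u)" if "u \<in> edom \<psi>" for u
    using ereal_real_edom[OF f(1)] ereal_real_edom[OF \<psi>(1) that] \<psi>(2) that
    by (metis F_def plus_ereal.simps(1) subsetD)
  have sub: "edom f \<subseteq> interior (edom d)"
    using f by (intro interior_maximal)
  have bounds: "0 \<le> bregman f u v \<and> bregman f u v \<le> L * bregman d u v"
    if uv: "u \<in> edom f" "v \<in> edom f" for u v
  proof -
    have "0 \<le> bregman d u v" using uv sub f by (intro bregman_nonneg[OF d]) auto
    then have "0 \<le> \<mu>\<^sub>d * bregman d u v" "L\<^sub>d * bregman d u v \<le> L * bregman d u v"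
      using constants params by (auto intro: mult_right_mono)
    then show ?thesis using relative_bounds[OF uv] by linarith
  qed
  have Zx: "finite (Z k)" "Z k \<subseteq> edom \<psi>" "x k \<in> Z k"
    and step: "inexact_step d f \<psi> L \<delta> (x k) (Z k) (x (Suc k))" for k
    using iterates by (auto simp: igmm_def)
  have x_dom: "x k \<in> edom \<psi>" for k using Zx by blast
  have one: "?F (x (Suc k)) + L * bregman d (x (Suc k)) y \<le> ?F y + L * bregman d (x k) y + \<delta>" for k
    by (rule inexact_step_descent[OF d \<psi>(1) f(2,3) \<psi>(2) bounds params(2) max_attained[OF params(2)]
          Zx step y])
  \<comment> \<open>Keeping the last Bregman term on the left makes the sum of the one-step inequalities telescope.\<close>
  have "(\<Sum>k=1..n. ?F (x k)) + L * bregman d (x n) y \<le> n * (?F y + \<delta>) + L * bregman d x\<^sub>0 y" for n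
  proof (induction n)
    case 0
    then show ?case by (simp add: start)
  next
    case (Suc n)
    then show ?case using one[of n] by (simp add: algebra_simps)
  qed
  moreover have "0 \<le> L * bregman d (x T) y"
    using x_dom y sub \<psi>(2) f(3) params(2) by (intro mult_nonneg_nonneg bregman_nonneg[OF d]) auto
  ultimately have "(\<Sum>k=1..T. ?F (x k)) \<le> T * (?F y + \<delta>) + L * bregman d x\<^sub>0 y"
    by (smt (verit))
  then have "1 / real T * (\<Sum>k=1..T. ?F (x k)) \<le> ?F y + L / real T * bregman d x\<^sub>0 y + \<delta>"
    using T by (simp add: field_simps)
  moreover have "(\<Sum>k=1..T. F (x k)) = ereal (\<Sum>k=1..T. ?F (x k))"
    by (simp add: F_real[OF x_dom])
  ultimately show ?thesis
    by (simp add: F_real[OF y])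
qed

end
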